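(* Let $n\ge2$ and let $\Omega\subset\mathbb{R}^n$ be an open set with nonempty boundary $\partial\Omega$ of class $C^{1,1}$. If there is a subset $\Gamma\subset\partial\Omega$ with $\mathcal{H}^{n-1}(\Gamma)=0$ such that $\partial\Omega\setminus\Gamma$ is $C^2$, meaning that for any $\xi\in\partial\Omega\setminus\Gamma$ there is an open neighborhood $U$ of $\xi$ in $\mathbb{R}^n$ such that $(\partial\Omega\setminus\Gamma)\cap U$ is a $C^2$-manifold (an embedded $C^2$ submanifold of $\mathbb{R}^n$), then $\mathcal{L}^n(\overline{\Sigma})=0$.
   Context: $\mathcal{L}^n$ is $n$-dimensional Lebesgue measure and $\mathcal{H}^{n-1}$ is $(n-1)$-dimensional Hausdorff measure. For an open set $\Omega\subset\mathbb{R}^n$ with nonempty boundary: $d(x):=\inf_{\xi\in\partial\Omega}|\xi-x|$ for $x\in\Omega$; $\pi(x):=\{\xi\in\partial\Omega \mid d(x)=|\xi-x|\}$; $\Sigma:=\{x\in\Omega\mid \pi(x)\text{ is not a singleton}\}$; $\overline{\Sigma}$ is the closure of $\Sigma$ in $\Omega$ (cut locus). "$\partial\Omega$ is of class $C^{1,1}$" has the usual meaning: near each boundary point, after a rigid motion, $\Omega$ coincides with the region strictly below the graph of a $C^1$ function of $n-1$ variables with Lipschitz gradient and $\partial\Omega$ coincides with that graph. *)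

theory Defs
  imports "HOL-Analysis.Analysis"
begin

section \<open>Hausdorff measure\<close>

text \<open>The normalisation is the usual one, \<open>\<alpha>(k) (diam C / 2) ^ k\<close> with \<open>\<alpha>(k)\<close> the volume of the
  unit ball of dimension \<open>k\<close>. Empty covering sets contribute nothing, also for \<open>k = 0\<close>.
  Boundedness is required because \<open>diameter\<close> is unspecified on unbounded sets.\<close>

definition hausdorff_premeasure :: "nat \<Rightarrow> real \<Rightarrow> 'a::metric_space set \<Rightarrow> ennreal" where
  "hausdorff_premeasure k \<delta> A =
    (INF C \<in> {C :: nat \<Rightarrow> 'a set. A \<subseteq> (\<Union>i. C i) \<and> (\<forall>i. bounded (C i) \<and> diameter (C i) \<le> \<delta>)}.
      \<Sum>i. if C i = {} then 0
           else ennreal (unit_ball_vol (real k) * (diameter (C i) / 2) ^ k))"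

definition hausdorff_measure :: "nat \<Rightarrow> 'a::metric_space set \<Rightarrow> ennreal" where
  "hausdorff_measure k A = (SUP \<delta> \<in> {0<..}. hausdorff_premeasure k \<delta> A)"


section \<open>Boundaries of class \<open>C\<^sup>1\<^sup>,\<^sup>1\<close>\<close>

definition rigid_motion :: "('a::euclidean_space \<Rightarrow> 'a) \<Rightarrow> bool" where
  "rigid_motion \<Phi> \<longleftrightarrow> (\<exists>Q b. orthogonal_transformation Q \<and> \<Phi> = (\<lambda>x. Q x + b))"

text \<open>Functions of \<open>n - 1\<close> variables are functions on the coordinate hyperplane
  \<open>{y. y \<bullet> e = 0}\<close>, where the basis vector \<open>e\<close> is the direction of the remaining variable;
  values of \<open>g\<close> off the hyperplane are irrelevant. \<open>G\<close> is the gradient of \<open>g\<close> on the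
  hyperplane; its Lipschitz continuity already makes \<open>g\<close> of class \<open>C\<^sup>1\<close>.\<close>

definition C11_on_hyperplane :: "'a::euclidean_space \<Rightarrow> ('a \<Rightarrow> real) \<Rightarrow> bool" where
  "C11_on_hyperplane e g \<longleftrightarrow>
    (\<exists>G L. (\<forall>y \<in> {y. y \<bullet> e = 0}. G y \<bullet> e = 0 \<and>
               (g has_derivative (\<lambda>h. G y \<bullet> h)) (at y within {y. y \<bullet> e = 0})) \<and>
           L-lipschitz_on {y. y \<bullet> e = 0} G)"

text \<open>After the rigid motion \<open>\<Phi>\<close>, a point \<open>y = \<Phi> x\<close> has last coordinate \<open>y \<bullet> e\<close>, and
  \<open>y - (y \<bullet> e) *\<^sub>R e\<close> collects the other \<open>n - 1\<close> coordinates.\<close>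

definition C11_boundary :: "'a::euclidean_space set \<Rightarrow> bool" where
  "C11_boundary \<Omega> \<longleftrightarrow>
    (\<forall>\<xi> \<in> frontier \<Omega>. \<exists>U \<Phi> e g. open U \<and> \<xi> \<in> U \<and> rigid_motion \<Phi> \<and> e \<in> Basis \<and>
       C11_on_hyperplane e g \<and>
       \<Omega> \<inter> U = {x \<in> U. \<Phi> x \<bullet> e < g (\<Phi> x - (\<Phi> x \<bullet> e) *\<^sub>R e)} \<and>
       frontier \<Omega> \<inter> U = {x \<in> U. \<Phi> x \<bullet> e = g (\<Phi> x - (\<Phi> x \<bullet> e) *\<^sub>R e)})"


section \<open>Embedded \<open>C\<^sup>2\<close> submanifolds\<close>

text \<open>Meant for open sets \<open>S\<close>.\<close>

definition C2_on :: "'a::real_normed_vector set \<Rightarrow> ('a \<Rightarrow> 'b::real_normed_vector) \<Rightarrow> bool" where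
  "C2_on S f \<longleftrightarrow>
    (\<exists>(f' :: 'a \<Rightarrow> 'a \<Rightarrow>\<^sub>L 'b) (f'' :: 'a \<Rightarrow> 'a \<Rightarrow>\<^sub>L ('a \<Rightarrow>\<^sub>L 'b)).
       (\<forall>x \<in> S. (f has_derivative blinfun_apply (f' x)) (at x)) \<and>
       (\<forall>x \<in> S. (f' has_derivative blinfun_apply (f'' x)) (at x)) \<and>
       continuous_on S f'')"

text \<open>Slice charts: a \<open>C\<^sup>2\<close>-diffeomorphism between open sets of the ambient space that maps \<open>M\<close>
  onto a piece of a linear subspace of dimension \<open>k\<close>.\<close>

definition C2_submanifold :: "nat \<Rightarrow> 'a::euclidean_space set \<Rightarrow> bool" where
  "C2_submanifold k M \<longleftrightarrow>
    (\<forall>p \<in> M. \<exists>(V :: 'a set) (W :: 'a set) \<phi> \<psi> S. open V \<and> p \<in> V \<and> open W \<and>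
       homeomorphism V W \<phi> \<psi> \<and>
       C2_on V \<phi> \<and> C2_on W \<psi> \<and> subspace S \<and> dim S = k \<and> \<phi> ` (M \<inter> V) = S \<inter> W)"


section \<open>Distance to the boundary and cut locus\<close>

definition boundary_dist :: "'a::euclidean_space set \<Rightarrow> 'a \<Rightarrow> real" where
  "boundary_dist \<Omega> x = infdist x (frontier \<Omega>)"

definition boundary_proj :: "'a::euclidean_space set \<Rightarrow> 'a \<Rightarrow> 'a set" where
  "boundary_proj \<Omega> x = {\<xi> \<in> frontier \<Omega>. boundary_dist \<Omega> x = dist \<xi> x}"

definition singular_set :: "'a::euclidean_space set \<Rightarrow> 'a set" where
  "singular_set \<Omega> = {x \<in> \<Omega>. \<not> is_singleton (boundary_proj \<Omega> x)}"

text \<open>The closure is taken relative to \<open>\<Omega>\<close>.\<close>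

definition cut_locus :: "'a::euclidean_space set \<Rightarrow> 'a set" where
  "cut_locus \<Omega> = \<Omega> \<inter> closure (singular_set \<Omega>)"

end

theory Submission
  imports Defs
begin

text \<open>Squared distances make the nearest-point projection a monotone relation, so the points with two
  far apart projections lie on countably many Lipschitz graphs, and \<open>\<Sigma>\<close> is null. A point of
  \<open>closure \<Sigma>\<close> outside \<open>\<Sigma>\<close> has a single projection \<open>\<xi>\<close> and is the image, under the locally Lipschitz map
  \<open>F\<close> sending a boundary point and a parameter to the point of the normal line with that parameter,
  of some \<open>z\<close> near which \<open>F\<close> is not injective. If \<open>\<xi> \<in> \<Gamma>\<close>, then \<open>z\<close> lies in the cylinder over \<open>\<Gamma>\<close>, which
  is null. Otherwise the boundary has a \<open>C\<^sup>2\<close> defining function near \<open>\<xi>\<close>, so \<open>F\<close> is \<open>C\<^sup>1\<close> near \<open>z\<close>,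
  its derivative at \<open>z\<close> is singular by the inverse function theorem, and Sard's theorem applies.\<close>

subsection \<open>Sard's theorem for maps with singular derivative\<close>

text \<open>The library's \<open>baby_Sard\<close> requires a well-ordered index type.\<close>

typedef 'a ordered_copy = "UNIV :: 'a set" by simp

definition copy_index :: "'a::finite ordered_copy \<Rightarrow> nat" where
  "copy_index x = (SOME f :: 'a \<Rightarrow> nat. inj f) (Rep_ordered_copy x)"

lemma inj_copy_index: "inj copy_index"
proof -
  have "\<exists>f :: 'a \<Rightarrow> nat. inj f"
    using finite_imp_inj_to_nat_seg[of "UNIV :: 'a set"] by auto
  then have "inj (SOME f :: 'a \<Rightarrow> nat. inj f)"
    by (rule someI_ex)
  then show ?thesis
    by (intro injI) (auto simp: copy_index_def Rep_ordered_copy_inject dest: injD[of "SOME f. inj f"])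
qed

instantiation ordered_copy :: (finite) wellorder
begin

definition "x \<le> y \<longleftrightarrow> copy_index x \<le> copy_index y"
definition "x < y \<longleftrightarrow> copy_index x < copy_index y"

instance
proof
  fix x y :: "'a ordered_copy" and P :: "'a ordered_copy \<Rightarrow> bool"
  show "x = y" if "x \<le> y" "y \<le> x"
    using that inj_copy_index by (auto simp: less_eq_ordered_copy_def inj_def)
  show "P x" if "\<And>x. (\<And>y. y < x \<Longrightarrow> P y) \<Longrightarrow> P x"
    by (rule measure_induct_rule[of copy_index P, OF that]) (simp add: less_ordered_copy_def)
qed (auto simp: less_eq_ordered_copy_def less_ordered_copy_def)

end

instance ordered_copy :: (finite) finite
proof
  have "(UNIV :: 'a ordered_copy set) = Abs_ordered_copy ` UNIV"
    using Rep_ordered_copy_inverse by (metis UNIV_eq_I rangeI)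
  then show "finite (UNIV :: 'a ordered_copy set)"
    by (metis finite finite_imageI)
qed

lemma CARD_ordered_copy [simp]: "CARD('a ordered_copy) = CARD('a)"
  by (rule type_definition.card[OF type_definition_ordered_copy])

text \<open>Relabelling the coordinates by the ordered copy is a linear bijection. It preserves
  differentiability, non-injectivity of the derivative and null sets, so Sard's theorem carries
  over.\<close>

lemma negligible_critical_values:
  fixes f :: "real^'n \<Rightarrow> real^'n"
  assumes der: "\<And>x. x \<in> S \<Longrightarrow> (f has_derivative f' x) (at x)"
    and ninj: "\<And>x. x \<in> S \<Longrightarrow> \<not> inj (f' x)"
  shows "negligible (f ` S)"
proof -
  define J :: "real^'n \<Rightarrow> real^'n ordered_copy" where "J x = (\<chi> i. x $ Rep_ordered_copy i)" for x
  define K :: "real^'n ordered_copy \<Rightarrow> real^'n" where "K y = (\<chi> i. y $ Abs_ordered_copy i)" for y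
  have KJ [simp]: "K (J x) = x" for x
    by (simp add: K_def J_def vec_eq_iff Abs_ordered_copy_inverse)
  have JK [simp]: "J (K y) = y" for y
    by (simp add: K_def J_def vec_eq_iff Rep_ordered_copy_inverse)
  have linJ: "linear J" and linK: "linear K"
    by (auto simp: J_def K_def vec_eq_iff intro!: linearI)
  then have blJ: "bounded_linear J" and blK: "bounded_linear K"
    by (simp_all add: linear_conv_bounded_linear)
  have "negligible ((\<lambda>y. J (f (K y))) ` (J ` S))"
  proof (rule baby_Sard)
    fix y assume "y \<in> J ` S"
    then have x: "K y \<in> S" by auto
    show "((\<lambda>y. J (f (K y))) has_derivative (\<lambda>h. J (f' (K y) (K h)))) (at y within J ` S)"
    proof (rule has_derivative_at_withinI, rule has_derivative_compose[OF _ bounded_linear_imp_has_derivative[OF blJ]])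
      show "((\<lambda>y. f (K y)) has_derivative (\<lambda>h. f' (K y) (K h))) (at y)"
        by (rule has_derivative_compose[OF bounded_linear_imp_has_derivative[OF blK] der[OF x]])
    qed
    have "linear (f' (K y))"
      by (rule has_derivative_linear[OF der[OF x]])
    then have lin: "linear (\<lambda>h. J (f' (K y) (K h)))"
      using linear_compose[OF linear_compose[OF linK] linJ] by (simp add: o_def)
    obtain a b where "a \<noteq> b" "f' (K y) a = f' (K y) b"
      using ninj[OF x] by (auto simp: inj_def)
    then have "J a \<noteq> J b"
      by (metis KJ)
    have "\<not> inj (\<lambda>h. J (f' (K y) (K h)))"
    proof
      assume "inj (\<lambda>h. J (f' (K y) (K h)))"
      from injD[OF this, of "J a" "J b"] show False
        using \<open>J a \<noteq> J b\<close> \<open>f' (K y) a = f' (K y) b\<close> by simp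
    qed
    moreover have "(*v) (matrix (\<lambda>h. J (f' (K y) (K h)))) = (\<lambda>h. J (f' (K y) (K h)))"
      using lin by (simp add: matrix_vector_mul linear_matrix_vector_mul_eq)
    ultimately show "rank (matrix (\<lambda>h. J (f' (K y) (K h)))) < CARD('n ordered_copy)"
      unfolding less_rank_noninjective by simp
  qed auto
  then have "negligible (K ` (\<lambda>y. J (f (K y))) ` (J ` S))"
    by (rule negligible_differentiable_image_negligible[rotated])
      (auto intro: bounded_linear_imp_differentiable_on[OF blK])
  then show ?thesis
    by (simp add: image_image)
qed

subsection \<open>Nearest boundary points\<close>

lemma boundary_proj_eq:
  "boundary_proj \<Omega> x = {\<xi> \<in> frontier \<Omega>. \<forall>\<eta> \<in> frontier \<Omega>. dist x \<xi> \<le> dist x \<eta>}"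
proof -
  have "infdist x (frontier \<Omega>) = dist x \<xi>"
    if "\<xi> \<in> frontier \<Omega>" "\<forall>\<eta> \<in> frontier \<Omega>. dist x \<xi> \<le> dist x \<eta>" for \<xi>
  proof (rule antisym)
    show "infdist x (frontier \<Omega>) \<le> dist x \<xi>"
      using that by (simp add: infdist_le)
    show "dist x \<xi> \<le> infdist x (frontier \<Omega>)"
      using that by (subst infdist_notempty) (auto intro!: cINF_greatest)
  qed
  then show ?thesis
    by (auto simp: boundary_proj_def boundary_dist_def dist_commute) (metis dist_commute infdist_le)
qed

lemma boundary_proj_nonempty:
  assumes "frontier \<Omega> \<noteq> {}"
  shows "boundary_proj \<Omega> x \<noteq> {}"
proof -
  obtain \<xi> where "\<xi> \<in> frontier \<Omega>" "\<And>\<eta>. \<eta> \<in> frontier \<Omega> \<Longrightarrow> dist x \<xi> \<le> dist x \<eta>"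
    using distance_attains_inf[OF frontier_closed assms, of x] by blast
  then show ?thesis
    by (auto simp: boundary_proj_eq)
qed

text \<open>Adding the two squared minimality inequalities cancels all squares and leaves only the
  mixed terms. In other words, projections are subgradients of the convex function
  \<open>(|x|^2 - d(x)^2) / 2\<close>, with \<open>d\<close> the distance to the boundary.\<close>

lemma boundary_proj_monotone:
  assumes "\<xi> \<in> boundary_proj \<Omega> x" "\<eta> \<in> boundary_proj \<Omega> y"
  shows "0 \<le> (\<xi> - \<eta>) \<bullet> (x - y)"
proof -
  have "norm (x - \<xi>) \<le> norm (x - \<eta>)" "norm (y - \<eta>) \<le> norm (y - \<xi>)"
    using assms by (auto simp: boundary_proj_eq dist_norm)
  then have "(x - \<xi>) \<bullet> (x - \<xi>) \<le> (x - \<eta>) \<bullet> (x - \<eta>)" "(y - \<eta>) \<bullet> (y - \<eta>) \<le> (y - \<xi>) \<bullet> (y - \<xi>)"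
    by (simp_all add: norm_le)
  then show ?thesis
    by (simp add: algebra_simps inner_commute)
qed

text \<open>The component of \<open>x - y\<close> along \<open>w\<close> is at most half its length,
  so the projection \<open>P\<close> along \<open>w\<close> is injective on \<open>S\<close> with a
  2-Lipschitz inverse. Hence \<open>S\<close> is a Lipschitz image of part of a hyperplane.\<close>

lemma negligible_of_cone_condition:
  fixes S :: "'a::euclidean_space set"
  assumes "w \<noteq> 0"
    and cone: "\<And>x y. x \<in> S \<Longrightarrow> y \<in> S \<Longrightarrow> \<bar>w \<bullet> (x - y)\<bar> \<le> norm w * norm (x - y) / 2"
  shows "negligible S"
proof -
  define P where "P x = x - (w \<bullet> x / (w \<bullet> w)) *\<^sub>R w" for x
  have lip: "norm (x - y) \<le> 2 * norm (P x - P y)" if "x \<in> S" "y \<in> S" for x y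
  proof -
    have "x - y = (P x - P y) + (w \<bullet> (x - y) / (w \<bullet> w)) *\<^sub>R w"
      by (simp add: P_def algebra_simps inner_diff_right diff_divide_distrib)
    then have "norm (x - y) \<le> norm (P x - P y) + norm ((w \<bullet> (x - y) / (w \<bullet> w)) *\<^sub>R w)"
      by (metis norm_triangle_ineq)
    also have "norm ((w \<bullet> (x - y) / (w \<bullet> w)) *\<^sub>R w) = \<bar>w \<bullet> (x - y)\<bar> / norm w"
      using \<open>w \<noteq> 0\<close> by (simp add: power2_norm_eq_inner[symmetric] power2_eq_square)
    also have "\<dots> \<le> norm (x - y) / 2"
      using cone[OF that] \<open>w \<noteq> 0\<close> by (simp add: field_simps)
    finally show ?thesis by simp
  qed
  have inj: "inj_on P S"
    using lip by (fastforce intro: inj_onI)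
  have "negligible (inv_into S P ` P ` S)"
  proof (rule negligible_locally_Lipschitz_image)
    show "negligible (P ` S)"
    proof (rule negligible_subset[OF negligible_hyperplane])
      show "w \<noteq> 0 \<or> 0 \<noteq> (0::real)" using \<open>w \<noteq> 0\<close> by simp
      show "P ` S \<subseteq> {x. w \<bullet> x = 0}"
        using \<open>w \<noteq> 0\<close> by (auto simp: P_def inner_diff_right)
    qed
    show "\<exists>T B. open T \<and> x \<in> T \<and>
        (\<forall>y \<in> P ` S \<inter> T. norm (inv_into S P y - inv_into S P x) \<le> B * norm (y - x))"
      if "x \<in> P ` S" for x
      using that lip inj by (intro exI[of _ UNIV] exI[of _ 2]) auto
  qed simp
  then show ?thesis
    using inj by simp
qed

text \<open>By monotonicity of the projection, the points having one projection near \<open>p\<close> and another near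
  \<open>q\<close> form a Lipschitz graph over a hyperplane orthogonal to \<open>p - q\<close>.\<close>

lemma negligible_singular_set:
  fixes \<Omega> :: "'a::euclidean_space set"
  assumes "frontier \<Omega> \<noteq> {}"
  shows "negligible (singular_set \<Omega>)"
proof -
  define S where "S p q r =
    {x. boundary_proj \<Omega> x \<inter> cball p r \<noteq> {} \<and> boundary_proj \<Omega> x \<inter> cball q r \<noteq> {}}" for p q r
  \<comment> \<open>The condition \<open>4 * r \<le> norm (p - q)\<close> turns the bound
    \<open>2 * r\<close> coming from monotonicity into the cone constant 1/2.\<close>
  have negl: "negligible (S p q r)" if "4 * r \<le> norm (p - q)" "p \<noteq> q" for p q r
  proof (rule negligible_of_cone_condition)
    show "p - q \<noteq> 0" using that by simp
    \<comment> \<open>\<open>\<xi> - \<eta>\<close> pairs nonnegatively with \<open>x - y\<close>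
      and differs from \<open>p - q\<close> by at most \<open>2 * r\<close> in norm. Exchanging
      \<open>x\<close> and \<open>y\<close> later gives the other side of the absolute
      value.\<close>
    have half: "(q - p) \<bullet> (x - y) \<le> 2 * r * norm (x - y)" if xy: "x \<in> S p q r" "y \<in> S p q r" for x y
    proof -
      obtain \<xi> \<eta> where \<xi>: "\<xi> \<in> boundary_proj \<Omega> x" "dist p \<xi> \<le> r"
        and \<eta>: "\<eta> \<in> boundary_proj \<Omega> y" "dist q \<eta> \<le> r"
        using xy by (auto simp: S_def)
      have "(q - p) \<bullet> (x - y) \<le> ((\<xi> - p) + (q - \<eta>)) \<bullet> (x - y)"
        using boundary_proj_monotone[OF \<xi>(1) \<eta>(1)] by (simp add: algebra_simps)
      also have "\<dots> \<le> norm ((\<xi> - p) + (q - \<eta>)) * norm (x - y)"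
        by (rule norm_cauchy_schwarz)
      also have "\<dots> \<le> (2 * r) * norm (x - y)"
      proof (rule mult_right_mono)
        show "norm ((\<xi> - p) + (q - \<eta>)) \<le> 2 * r"
          using norm_triangle_ineq[of "\<xi> - p" "q - \<eta>"] \<xi>(2) \<eta>(2) by (simp add: dist_norm norm_minus_commute)
      qed simp
      finally show ?thesis .
    qed
    show "\<bar>(p - q) \<bullet> (x - y)\<bar> \<le> norm (p - q) * norm (x - y) / 2"
      if xy: "x \<in> S p q r" "y \<in> S p q r" for x y
    proof -
      have "\<bar>(p - q) \<bullet> (x - y)\<bar> \<le> 2 * r * norm (x - y)"
        using half[OF xy] half[OF xy(2,1)] by (simp add: algebra_simps norm_minus_commute)
      moreover have "4 * r * norm (x - y) \<le> norm (p - q) * norm (x - y)"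
        using that \<open>4 * r \<le> norm (p - q)\<close> by (intro mult_right_mono) auto
      ultimately show ?thesis by simp
    qed
  qed
  obtain D :: "'a set" where D: "countable D" "\<And>X. open X \<Longrightarrow> X \<noteq> {} \<Longrightarrow> \<exists>d \<in> D. d \<in> X"
    using countable_dense_setE by blast
  define I where "I = {(p, q, n :: nat). p \<in> D \<and> q \<in> D \<and> p \<noteq> q \<and> 4 * inverse (real (Suc n)) \<le> norm (p - q)}"
  have "countable I"
    by (rule countable_subset[of _ "D \<times> D \<times> UNIV"]) (auto simp: I_def D(1))
  then have "negligible (\<Union>((\<lambda>(p, q, n). S p q (inverse (real (Suc n)))) ` I))"
    by (intro negligible_countable_Union countable_image) (auto simp: I_def intro!: negl)
  moreover have "singular_set \<Omega> \<subseteq> (\<Union>((\<lambda>(p, q, n). S p q (inverse (real (Suc n)))) ` I))"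
  proof
    fix x assume "x \<in> singular_set \<Omega>"
    then obtain \<xi> \<eta> where \<xi>\<eta>: "\<xi> \<in> boundary_proj \<Omega> x" "\<eta> \<in> boundary_proj \<Omega> x" "\<xi> \<noteq> \<eta>"
      using boundary_proj_nonempty[OF assms, of x] unfolding singular_set_def is_singleton_def by blast
    \<comment> \<open>With \<open>r < dist \<xi> \<eta> / 8\<close> the approximating points satisfy
      \<open>dist p q > 6 * r\<close>, more than the \<open>4 * r\<close> demanded by
      \<open>I\<close>.\<close>
    then obtain n where n: "inverse (real (Suc n)) < dist \<xi> \<eta> / 8"
      using reals_Archimedean[of "dist \<xi> \<eta> / 8"] by auto
    define r where "r = inverse (real (Suc n))"
    have "r > 0" by (simp add: r_def)
    obtain p where p: "p \<in> D" "dist \<xi> p < r"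
      using D(2)[of "ball \<xi> r"] \<open>r > 0\<close> by auto
    obtain q where q: "q \<in> D" "dist \<eta> q < r"
      using D(2)[of "ball \<eta> r"] \<open>r > 0\<close> by auto
    have "dist \<xi> \<eta> \<le> dist \<xi> p + dist p q + dist \<eta> q"
      by metric
    then have "4 * r \<le> dist p q"
      using n p q \<open>r > 0\<close> unfolding r_def[symmetric] by linarith
    moreover have "p \<noteq> q"
      using calculation \<open>r > 0\<close> by auto
    ultimately have "(p, q, n) \<in> I"
      using p q by (simp add: I_def r_def dist_norm)
    moreover have "x \<in> S p q r"
      using \<xi>\<eta> p q by (auto simp: S_def disjoint_iff dist_commute intro!: less_imp_le)
    ultimately show "x \<in> (\<Union>((\<lambda>(p, q, n). S p q (inverse (real (Suc n)))) ` I))"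
      by (auto simp: r_def)
  qed
  ultimately show ?thesis
    by (rule negligible_subset)
qed

subsection \<open>Cylinders over Hausdorff null sets\<close>

text \<open>In a slab of height \<open>2 * R\<close>, the cylinder over a covering set of diameter
  \<open>d\<close> fits into a box whose other sides are \<open>2 * d\<close>, since
  \<open>\<Phi>\<close> preserves distances. The volume of this box is a fixed multiple of the term
  of the set in the Hausdorff sum. Countably many slabs exhaust the cylinder.\<close>

lemma negligible_cylinder_hausdorff_null:
  fixes e :: "'a::euclidean_space" and \<Gamma> :: "'a set"
  assumes dim: "DIM('a) \<ge> 2" and e: "e \<in> Basis"
    and null: "hausdorff_measure (DIM('a) - 1) \<Gamma> = 0"
    and iso: "\<And>x y. dist (\<Phi> x) (\<Phi> y) = dist x y"
  shows "negligible {z. \<exists>\<xi>\<in>\<Gamma>. \<forall>b\<in>Basis - {e}. z \<bullet> b = (\<Phi> \<xi> :: 'a) \<bullet> b}"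
proof -
  define k where "k = DIM('a) - 1"
  define Z where "Z R = {z. \<bar>z \<bullet> e\<bar> \<le> R \<and> (\<exists>\<xi>\<in>\<Gamma>. \<forall>b\<in>Basis - {e}. z \<bullet> b = \<Phi> \<xi> \<bullet> b)}" for R
  have "k > 0" "card (Basis - {e}) = k"
    using dim e by (auto simp: k_def)
  have "negligible (Z R)" if "R \<ge> 0" for R
    unfolding negligible_outer_le
  proof (intro allI impI)
    fix \<epsilon> :: real assume "\<epsilon> > 0"
    define \<alpha> where "\<alpha> = unit_ball_vol (real k)"
    have "\<alpha> > 0" by (simp add: \<alpha>_def)
    \<comment> \<open>The factor between the box volume \<open>2 * R * (2 * d) ^ k\<close> and the
      Hausdorff term \<open>\<alpha> * (d / 2) ^ k\<close>.\<close>
    define c where "c = 2 * R * 4 ^ k / \<alpha>"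
    have "c \<ge> 0" using \<open>\<alpha> > 0\<close> \<open>R \<ge> 0\<close> by (simp add: c_def)
    have "hausdorff_premeasure k 1 \<Gamma> \<le> hausdorff_measure k \<Gamma>"
      unfolding hausdorff_measure_def by (rule SUP_upper) simp
    \<comment> \<open>The measure is a supremum over scales, so its vanishing makes the premeasure
      vanish at scale 1. The denominator \<open>c + 1\<close> is positive also for
      \<open>R = 0\<close>, where \<open>c = 0\<close>.\<close>
    then have "hausdorff_premeasure k 1 \<Gamma> < ennreal (\<epsilon> / (c + 1))"
      using null \<open>\<epsilon> > 0\<close> \<open>c \<ge> 0\<close> by (simp add: k_def)
    then obtain C where cover: "\<Gamma> \<subseteq> (\<Union>i. C i)" and bdd: "\<And>i :: nat. bounded (C i)"
      and sum: "(\<Sum>i. if C i = {} then 0 else ennreal (\<alpha> * (diameter (C i) / 2) ^ k)) < ennreal (\<epsilon> / (c + 1))"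
      unfolding hausdorff_premeasure_def INF_less_iff \<alpha>_def by auto
    define p where "p i = (SOME x. x \<in> C i)" for i
    define l where "l i = (\<Sum>b\<in>Basis. (if b = e then - R else \<Phi> (p i) \<bullet> b - diameter (C i)) *\<^sub>R b)" for i
    define u where "u i = (\<Sum>b\<in>Basis. (if b = e then R else \<Phi> (p i) \<bullet> b + diameter (C i)) *\<^sub>R b)" for i
    \<comment> \<open>For an empty covering set the point \<open>p i\<close> is arbitrary and the
      premeasure counts 0, so the box has to be empty too.\<close>
    define B where "B i = (if C i = {} then {} else cbox (l i) (u i))" for i
    have p: "p i \<in> C i" if "C i \<noteq> {}" for i
      using that by (auto simp: p_def some_in_eq)
    have emB: "emeasure lborel (B i) =
        ennreal c * (if C i = {} then 0 else ennreal (\<alpha> * (diameter (C i) / 2) ^ k))" for i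
    proof (cases "C i = {}")
      case False
      have d: "diameter (C i) \<ge> 0" by (rule diameter_ge_0[OF bdd])
      have lu: "(u i - l i) \<bullet> b = (if b = e then 2 * R else 2 * diameter (C i))" if "b \<in> Basis" for b
        using that by (simp add: l_def u_def inner_diff_left)
      then have "\<forall>b\<in>Basis. l i \<bullet> b \<le> u i \<bullet> b"
        using d \<open>R \<ge> 0\<close> by (simp add: inner_diff_left split: if_splits) (smt (verit))
      then have "emeasure lborel (cbox (l i) (u i)) = ennreal (\<Prod>b\<in>Basis. (u i - l i) \<bullet> b)"
        by (simp add: emeasure_lborel_cbox_eq)
      also have "(\<Prod>b\<in>Basis. (u i - l i) \<bullet> b) = (\<Prod>b\<in>Basis. if b = e then 2 * R else 2 * diameter (C i))"
        by (rule prod.cong) (auto simp: lu)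
      also have "\<dots> = 2 * R * (2 * diameter (C i)) ^ k"
        using e \<open>card (Basis - {e}) = k\<close> by (subst prod.remove[of _ e]) auto
      also have "\<dots> = c * (\<alpha> * (diameter (C i) / 2) ^ k)"
      proof -
        have "(2 * diameter (C i)) ^ k = 4 ^ k * (diameter (C i) / 2) ^ k"
          by (subst power_mult_distrib[symmetric]) simp
        then show ?thesis
          using \<open>\<alpha> > 0\<close> by (simp add: c_def)
      qed
      finally show ?thesis
        using False \<open>c \<ge> 0\<close> by (simp add: B_def ennreal_mult')
    qed (simp add: B_def)
    have B: "B i \<in> sets lborel" for i
      by (simp add: B_def)
    have "emeasure lborel (\<Union>i. B i) \<le> (\<Sum>i. emeasure lborel (B i))"
      by (rule emeasure_subadditive_countably) (use B in auto)
    also have "\<dots> = ennreal c * (\<Sum>i. if C i = {} then 0 else ennreal (\<alpha> * (diameter (C i) / 2) ^ k))"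
      unfolding emB by (rule ennreal_suminf_cmult)
    also have "\<dots> \<le> ennreal c * ennreal (\<epsilon> / (c + 1))"
      using sum by (intro mult_left_mono) auto
    also have "\<dots> = ennreal (c * (\<epsilon> / (c + 1)))"
      using \<open>c \<ge> 0\<close> by (rule ennreal_mult'[symmetric])
    also have "\<dots> \<le> ennreal \<epsilon>"
      using \<open>c \<ge> 0\<close> \<open>\<epsilon> > 0\<close> by (intro ennreal_leI) (simp add: field_simps)
    finally have em: "emeasure lborel (\<Union>i. B i) \<le> ennreal \<epsilon>" .
    have "(\<Union>i. B i) \<in> fmeasurable lborel"
      using B em by (intro fmeasurableI) (auto intro: le_less_trans)
    then have "(\<Union>i. B i) \<in> lmeasurable" "measure lebesgue (\<Union>i. B i) \<le> \<epsilon>"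
      using em \<open>\<epsilon> > 0\<close> by (auto simp: measure_def fmeasurable_def enn2real_leI)
    moreover have "Z R \<subseteq> (\<Union>i. B i)"
    proof
      fix z assume "z \<in> Z R"
      then obtain \<xi> where ze: "\<bar>z \<bullet> e\<bar> \<le> R" and "\<xi> \<in> \<Gamma>" and z: "\<And>b. b \<in> Basis - {e} \<Longrightarrow> z \<bullet> b = \<Phi> \<xi> \<bullet> b"
        by (auto simp: Z_def)
      then obtain i where i: "\<xi> \<in> C i" using cover by auto
      then have "norm (\<Phi> \<xi> - \<Phi> (p i)) \<le> diameter (C i)"
        using diameter_bounded_bound[OF bdd[of i] i p[of i]] iso by (auto simp: dist_norm)
      then have "\<bar>\<Phi> \<xi> \<bullet> b - \<Phi> (p i) \<bullet> b\<bar> \<le> diameter (C i)" if "b \<in> Basis" for b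
        using Basis_le_norm[OF that, of "\<Phi> \<xi> - \<Phi> (p i)"] by (simp add: inner_diff_left)
      then have "z \<in> cbox (l i) (u i)"
        using ze z by (auto simp: mem_box l_def u_def abs_le_iff) (smt (verit))+
      then show "z \<in> (\<Union>i. B i)"
        using i by (auto simp: B_def)
    qed
    ultimately show "\<exists>T. Z R \<subseteq> T \<and> T \<in> lmeasurable \<and> measure lebesgue T \<le> \<epsilon>"
      by blast
  qed
  then have "negligible (\<Union>n. Z (real n))"
    by (intro negligible_Union_nat) simp
  then show ?thesis
    by (rule negligible_subset) (auto simp: Z_def real_arch_simple)
qed

subsection \<open>Normal coordinates over a \<open>C\<^sup>1\<^sup>,\<^sup>1\<close> graph\<close>

text \<open>The inverse function argument uses continuity of the derivative at \<open>a\<close> in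
  operator norm. Continuity in each fixed direction gives this, because the operator norm is at most
  the sum of the norms on the basis vectors.\<close>

lemma locally_injective_of_C1:
  fixes f :: "'a::euclidean_space \<Rightarrow> 'a"
  assumes "open S" "a \<in> S"
    and der: "\<And>x. x \<in> S \<Longrightarrow> (f has_derivative f' x) (at x)"
    and cont: "\<And>h. isCont (\<lambda>x. f' x h) a"
    and inj: "inj (f' a)"
  shows "\<exists>r>0. inj_on f (ball a r)"
proof -
  have bl: "bounded_linear (f' x)" if "x \<in> S" for x
    by (rule has_derivative_bounded_linear[OF der[OF that]])
  then have "linear (f' a)"
    using \<open>a \<in> S\<close> by (simp add: linear_conv_bounded_linear)
  then obtain g where g: "linear g" "g \<circ> f' a = id"
    using linear_injective_left_inverse inj by blast
  have "\<exists>d>0. \<forall>x. dist a x < d \<longrightarrow> onorm (\<lambda>v. f' x v - f' a v) < \<epsilon>" if "\<epsilon> > 0" for \<epsilon>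
  proof -
    have "((\<lambda>x. \<Sum>i\<in>Basis. norm (f' x i - f' a i)) \<longlongrightarrow> (\<Sum>i\<in>Basis. norm (f' a i - f' a i))) (nhds a)"
      using cont tendsto_at_iff_tendsto_nhds[of "\<lambda>x. f' x i" a for i]
      by (intro tendsto_intros) (simp add: isCont_def)
    then have "\<forall>\<^sub>F x in nhds a. (\<Sum>i\<in>Basis. norm (f' x i - f' a i)) < \<epsilon>"
      using \<open>\<epsilon> > 0\<close> by (auto dest: order_tendstoD(2))
    moreover have "\<forall>\<^sub>F x in nhds a. x \<in> S"
      using assms(1,2) by (rule eventually_nhds_in_open)
    ultimately have "\<forall>\<^sub>F x in nhds a. onorm (\<lambda>v. f' x v - f' a v) < \<epsilon>"
    proof eventually_elim
      case (elim x)
      have "onorm (\<lambda>v. f' x v - f' a v) \<le> (\<Sum>i\<in>Basis. norm (f' x i - f' a i))"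
        using bl elim(2) \<open>a \<in> S\<close> by (intro onorm_componentwise bounded_linear_sub)
      then show ?case using elim(1) by simp
    qed
    then show ?thesis
      by (auto simp: eventually_nhds_metric dist_commute)
  qed
  moreover have "bounded_linear g"
    using g(1) by (simp add: linear_conv_bounded_linear)
  ultimately obtain r where "r > 0" "inj_on f (ball a r)"
    using has_derivative_locally_injective[OF assms(2,1) _ g(2) der] by blast
  then show ?thesis
    by blast
qed

text \<open>The functions \<open>f\<close> and \<open>N\<close> are the graph function of a chart and its gradient, extended to the
  whole space so as not to depend on the coordinate along \<open>e\<close>.\<close>

locale C11_graph =
  fixes e :: "'a::euclidean_space" and f :: "'a \<Rightarrow> real" and N :: "'a \<Rightarrow> 'a" and L :: real
  assumes e: "e \<in> Basis"
    and f_der: "(f has_derivative (\<lambda>h. N z \<bullet> h)) (at z)"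
    and N_e: "N z \<bullet> e = 0"
    and f_shift: "f (z + t *\<^sub>R e) = f z"
    and N_shift: "N (z + t *\<^sub>R e) = N z"
    and N_lipschitz: "norm (N x - N y) \<le> L * norm (x - y)"
begin

section \<open>Foot points on the graph and the normal lines through them\<close>

definition graph_point :: "'a \<Rightarrow> 'a" where
  "graph_point z = z + (f z - z \<bullet> e) *\<^sub>R e"

text \<open>The map \<open>F\<close> of the overview. The foot does not depend on the
  \<open>e\<close>-coordinate of \<open>z\<close>, so that coordinate is free to serve as the
  parameter along the normal. The normal \<open>N z - e\<close> points below the graph and is scaled
  to have \<open>e\<close>-coordinate -1.\<close>

definition normal_point :: "'a \<Rightarrow> 'a" where
  "normal_point z = graph_point z + (z \<bullet> e) *\<^sub>R (N z - e)"

lemma ee [simp]: "e \<bullet> e = 1"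
  using e by simp

lemma graph_point_inner_e: "graph_point z \<bullet> e = f z"
  by (simp add: graph_point_def inner_add_left)

lemma f_graph_point: "f (graph_point z) = f z"
  by (simp add: graph_point_def f_shift)

lemma graph_point_shift: "graph_point (z + t *\<^sub>R e) = graph_point z"
  by (simp add: graph_point_def f_shift inner_add_left scaleR_add_left [symmetric] add.assoc)

lemma graph_point_eq: "p \<bullet> e = f p \<Longrightarrow> graph_point p = p"
  by (simp add: graph_point_def)

lemma graph_point_has_derivative:
  "(graph_point has_derivative (\<lambda>h. h + (N z \<bullet> h - h \<bullet> e) *\<^sub>R e)) (at z)"
  unfolding graph_point_def [abs_def]
  by (rule has_derivative_add[OF has_derivative_ident has_derivative_scaleR_left[OF
        has_derivative_diff[OF f_der has_derivative_inner_left[OF has_derivative_ident]]]])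

lemma continuous_on_graph_point: "continuous_on A graph_point"
  by (intro continuous_at_imp_continuous_on ballI has_derivative_continuous[OF graph_point_has_derivative])

lemma isCont_N: "isCont N z"
proof -
  have "((\<lambda>y. L * norm (y - z)) \<longlongrightarrow> L * norm (z - z)) (at z)"
    by (intro tendsto_intros)
  then have "((\<lambda>y. L * norm (y - z)) \<longlongrightarrow> 0) (at z)"
    by simp
  then have "((\<lambda>y. N y - N z) \<longlongrightarrow> 0) (at z)"
    by (rule Lim_null_comparison[rotated]) (rule always_eventually, rule allI, rule N_lipschitz)
  then show ?thesis
    by (simp add: isCont_def LIM_zero_iff)
qed

text \<open>The map in \<open>h\<close> is the derivative of \<open>graph_point\<close>, with the
  tangent space as range. Its adjoint sends \<open>w\<close> to
  \<open>w + (w \<bullet> e) *\<^sub>R (N z - e)\<close>, and the kernel of the adjoint is the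
  normal line.\<close>

lemma orthogonal_graph_tangent_iff:
  "(\<forall>h. w \<bullet> (h + (N z \<bullet> h - h \<bullet> e) *\<^sub>R e) = 0) \<longleftrightarrow> w = - (w \<bullet> e) *\<^sub>R (N z - e)"
proof -
  have "w \<bullet> (h + (N z \<bullet> h - h \<bullet> e) *\<^sub>R e) = (w + (w \<bullet> e) *\<^sub>R (N z - e)) \<bullet> h" for h
    by (simp add: inner_add_left inner_diff_left inner_add_right algebra_simps inner_commute)
  then have "(\<forall>h. w \<bullet> (h + (N z \<bullet> h - h \<bullet> e) *\<^sub>R e) = 0) \<longleftrightarrow> w + (w \<bullet> e) *\<^sub>R (N z - e) = 0"
    using inner_eq_zero_iff[of "w + (w \<bullet> e) *\<^sub>R (N z - e)"] by (auto simp del: inner_eq_zero_iff)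
  then show ?thesis
    by (simp only: scaleR_minus_left eq_neg_iff_add_eq_0)
qed

text \<open>At a nearest point \<open>p\<close> the vector \<open>v - p\<close> is normal to the
  graph. The normal has \<open>e\<close>-coordinate -1, so the parameter is
  \<open>(p - v) \<bullet> e\<close>, which is the \<open>e\<close>-coordinate of
  \<open>p - (v \<bullet> e) *\<^sub>R e\<close>.\<close>

lemma nearest_graph_point:
  assumes "open U" "p \<in> U" and p: "p \<bullet> e = f p"
    and min: "\<And>q. q \<in> U \<Longrightarrow> q \<bullet> e = f q \<Longrightarrow> dist v p \<le> dist v q"
  shows "v = normal_point (p - (v \<bullet> e) *\<^sub>R e)"
proof -
  \<comment> \<open>Composing the squared distance with \<open>graph_point\<close> turns the
    constrained minimum into a free one over an open set.\<close>
  define q where "q x = (v - graph_point x) \<bullet> (v - graph_point x)" for x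
  have "(q has_derivative (\<lambda>h. - 2 * ((v - p) \<bullet> (h + (N p \<bullet> h - h \<bullet> e) *\<^sub>R e)))) (at p)"
    unfolding q_def [abs_def]
    by (auto intro!: derivative_eq_intros graph_point_has_derivative 
        simp: graph_point_eq[OF p] inner_commute inner_add_right inner_diff_right algebra_simps)
  moreover have "open (graph_point -` U)"
    using \<open>open U\<close> continuous_on_graph_point by (rule open_vimage)
  moreover have "p \<in> graph_point -` U"
    using \<open>p \<in> U\<close> by (simp add: graph_point_eq[OF p])
  moreover have "\<forall>x \<in> graph_point -` U. q p \<le> q x"
  proof
    fix x assume "x \<in> graph_point -` U"
    then have "norm (v - p) \<le> norm (v - graph_point x)"
      using min[of "graph_point x"] by (simp add: dist_norm graph_point_inner_e f_graph_point)
    then show "q p \<le> q x"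
      by (simp add: q_def graph_point_eq[OF p] norm_le)
  qed
  ultimately have "(\<lambda>h. - 2 * ((v - p) \<bullet> (h + (N p \<bullet> h - h \<bullet> e) *\<^sub>R e))) = (\<lambda>h. 0)"
    by (intro differential_zero_maxmin[where S = "graph_point -` U"]) auto
  then have "\<forall>h. (v - p) \<bullet> (h + (N p \<bullet> h - h \<bullet> e) *\<^sub>R e) = 0"
    by (auto simp: fun_eq_iff)
  then have "v - p = - ((v - p) \<bullet> e) *\<^sub>R (N p - e)"
    by (simp only: orthogonal_graph_tangent_iff)
  moreover have "graph_point (p - (v \<bullet> e) *\<^sub>R e) = p" "N (p - (v \<bullet> e) *\<^sub>R e) = N p"
    using graph_point_shift[of p "- (v \<bullet> e)"] N_shift[of p "- (v \<bullet> e)"] graph_point_eq[OF p] by simp_all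
  ultimately show ?thesis
    by (simp add: normal_point_def inner_diff_left algebra_simps)
qed

text \<open>\<open>N\<close> is only Lipschitz, so \<open>normal_point\<close> need not be
  differentiable, but a Lipschitz bound between each point and its neighbours is enough to preserve
  null sets.\<close>

lemma negligible_normal_point_image:
  assumes "negligible T"
  shows "negligible (normal_point ` T)"
proof (rule negligible_locally_Lipschitz_image)
  fix x assume "x \<in> T"
  define g' where "g' = (\<lambda>h. h + (N x \<bullet> h - h \<bullet> e) *\<^sub>R e)"
  have "(graph_point has_derivative g') (at x)"
    using graph_point_has_derivative by (simp add: g'_def)
  then obtain d where d: "d > 0"
    "\<And>y. norm (y - x) < d \<Longrightarrow> norm (graph_point y - graph_point x - g' (y - x)) \<le> 1 * norm (y - x)"
    and bl: "bounded_linear g'"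
    unfolding has_derivative_at_alt by (metis zero_less_one)
  obtain K where K: "\<And>h. norm (g' h) \<le> norm h * K"
    using bounded_linear.bounded[OF bl] by blast
  \<comment> \<open>\<open>1 + K\<close> comes from differentiability of \<open>graph_point\<close>
    at \<open>x\<close>, \<open>(norm x + d) * L\<close> from the variation of \<open>N\<close> at a
    bounded parameter, and \<open>norm (N x - e)\<close> from the change of the parameter.\<close>
  define B where "B = 1 + K + (norm x + d) * L + norm (N x - e)"
  have "norm (normal_point y - normal_point x) \<le> B * norm (y - x)" if y: "norm (y - x) < d" for y
  proof -
    have "norm (graph_point y - graph_point x) \<le> norm (graph_point y - graph_point x - g' (y - x)) + norm (g' (y - x))"
      by (metis diff_add_cancel norm_triangle_ineq)
    also have "\<dots> \<le> (1 + K) * norm (y - x)"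
      using d(2)[OF y] K[of "y - x"] by (simp add: algebra_simps)
    finally have 1: "norm (graph_point y - graph_point x) \<le> (1 + K) * norm (y - x)" .
    have "\<bar>y \<bullet> e\<bar> \<le> norm y"
      using e by (rule Basis_le_norm)
    also have "\<dots> \<le> norm x + d"
      using y norm_triangle_ineq2[of y x] by simp
    finally have "\<bar>y \<bullet> e\<bar> * norm (N y - N x) \<le> (norm x + d) * (L * norm (y - x))"
      using N_lipschitz d(1) by (intro mult_mono) auto
    then have 2: "norm ((y \<bullet> e) *\<^sub>R (N y - N x)) \<le> (norm x + d) * L * norm (y - x)"
      by simp
    have 3: "norm (((y - x) \<bullet> e) *\<^sub>R (N x - e)) \<le> norm (N x - e) * norm (y - x)"
      using mult_left_mono[OF Basis_le_norm[OF e, of "y - x"] norm_ge_zero[of "N x - e"]]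
      by (simp add: mult.commute)
    have "normal_point y - normal_point x =
        (graph_point y - graph_point x) + ((y \<bullet> e) *\<^sub>R (N y - N x) + ((y - x) \<bullet> e) *\<^sub>R (N x - e))"
      by (simp add: normal_point_def algebra_simps inner_diff_left)
    then have "norm (normal_point y - normal_point x) \<le> norm (graph_point y - graph_point x) +
        (norm ((y \<bullet> e) *\<^sub>R (N y - N x)) + norm (((y - x) \<bullet> e) *\<^sub>R (N x - e)))"
      by (metis norm_triangle_le norm_triangle_ineq add_left_mono)
    also have "\<dots> \<le> B * norm (y - x)"
      using 1 2 3 by (simp add: B_def distrib_right)
    finally show ?thesis .
  qed
  then show "\<exists>U B. open U \<and> x \<in> U \<and> (\<forall>y\<in>T \<inter> U. norm (normal_point y - normal_point x) \<le> B * norm (y - x))"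
    using d(1) by (intro exI[of _ "ball x d"] exI[of _ B]) (auto simp: dist_norm norm_minus_commute)
qed (use assms in auto)

lemma normal_point_has_derivative:
  assumes "(N has_derivative N') (at z)"
  shows "(normal_point has_derivative
      (\<lambda>h. h + (N z \<bullet> h - h \<bullet> e) *\<^sub>R e + ((z \<bullet> e) *\<^sub>R N' h + (h \<bullet> e) *\<^sub>R (N z - e)))) (at z)"
proof -
  have "((\<lambda>z. N z - e) has_derivative N') (at z)"
    using has_derivative_diff[OF assms has_derivative_const[of e]] by simp
  then show ?thesis
    unfolding normal_point_def [abs_def]
    by (rule has_derivative_add[OF graph_point_has_derivative
          has_derivative_scaleR[OF has_derivative_inner_left[OF has_derivative_ident]]])
qed

text \<open>The conclusion is arranged for contraposition: if \<open>normal_point\<close> is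
  injective on no ball around \<open>z\<close>, then \<open>z\<close> is a critical point.\<close>

lemma normal_point_locally_injective:
  assumes "open S" "z \<in> S"
    and der: "\<And>x. x \<in> S \<Longrightarrow> (N has_derivative N' x) (at x)"
    and cont: "\<And>h. isCont (\<lambda>x. N' x h) z"
  shows "\<exists>F'. (normal_point has_derivative F') (at z) \<and> (inj F' \<longrightarrow> (\<exists>r>0. inj_on normal_point (ball z r)))"
proof -
  define F' where "F' x h = h + (N x \<bullet> h - h \<bullet> e) *\<^sub>R e + ((x \<bullet> e) *\<^sub>R N' x h + (h \<bullet> e) *\<^sub>R (N x - e))" for x h
  have F': "(normal_point has_derivative F' x) (at x)" if "x \<in> S" for x
    using normal_point_has_derivative[OF der[OF that]] by (simp add: F'_def [abs_def])
  have "isCont (\<lambda>x. F' x h) z" for h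
    unfolding F'_def by (intro continuous_intros isCont_N cont)
  then show ?thesis
    using locally_injective_of_C1[OF assms(1,2) F'] F'[OF assms(2)] by blast
qed

text \<open>Differentiating \<open>w \<circ> graph_point = 0\<close> shows that the gradient \<open>D\<close> of \<open>w\<close> is normal to the graph,
  which expresses \<open>N\<close> through \<open>D\<close>.\<close>

lemma C1_gradient_of_defining_function:
  assumes "open V" "graph_point z \<in> V"
    and w: "\<And>p. p \<in> V \<Longrightarrow> (w has_derivative (\<lambda>h. D p \<bullet> h)) (at p)"
    and D: "\<And>p. p \<in> V \<Longrightarrow> (D has_derivative D' p) (at p)"
    and D': "\<And>h. continuous_on V (\<lambda>p. D' p h)"
    and zero: "\<And>x. graph_point x \<in> V \<Longrightarrow> w (graph_point x) = 0"
    and nz: "D (graph_point z) \<noteq> 0"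
  obtains S N' where "open S" "z \<in> S" "\<And>x. x \<in> S \<Longrightarrow> (N has_derivative N' x) (at x)"
    "\<And>h. isCont (\<lambda>x. N' x h) z"
proof -
  define T where "T = graph_point -` V"
  have "open T"
    unfolding T_def using \<open>open V\<close> continuous_on_graph_point by (rule open_vimage)
  define \<gamma>' where "\<gamma>' x h = h + (N x \<bullet> h - h \<bullet> e) *\<^sub>R e" for x h
  have \<gamma>: "(graph_point has_derivative \<gamma>' x) (at x)" for x
    using graph_point_has_derivative by (simp add: \<gamma>'_def [abs_def])
  have eq: "D (graph_point x) = - (D (graph_point x) \<bullet> e) *\<^sub>R (N x - e)" if "x \<in> T" for x
  proof -
    have "((\<lambda>x. w (graph_point x)) has_derivative (\<lambda>h. D (graph_point x) \<bullet> \<gamma>' x h)) (at x)"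
      using has_derivative_compose[OF \<gamma> w] that by (simp add: T_def)
    moreover have "((\<lambda>x. w (graph_point x)) has_derivative (\<lambda>h. 0)) (at x)"
      by (rule has_derivative_transform_within_open[of "\<lambda>x. 0", OF _ \<open>open T\<close> that]) (auto simp: T_def zero)
    ultimately have "(\<lambda>h. D (graph_point x) \<bullet> \<gamma>' x h) = (\<lambda>h. 0)"
      by (rule has_derivative_unique)
    then show ?thesis
      unfolding orthogonal_graph_tangent_iff[symmetric] \<gamma>'_def by (auto simp: fun_eq_iff)
  qed
  define E where "E x = D (graph_point x)" for x
  define E' where "E' x h = D' (graph_point x) (\<gamma>' x h)" for x h
  have E: "(E has_derivative E' x) (at x)" if "x \<in> T" for x
    using has_derivative_compose[OF \<gamma> D] that by (simp add: T_def E_def [abs_def] E'_def [abs_def])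
  have contE: "continuous_on T E"
    by (intro continuous_at_imp_continuous_on ballI has_derivative_continuous[OF E])
  \<comment> \<open>Where the \<open>e\<close>-component of the normal \<open>E\<close> is nonzero,
    \<open>eq\<close> can be solved for \<open>N\<close>. This is so at \<open>z\<close>, because by
    \<open>eq\<close> a vanishing component would force \<open>E z = 0\<close>.\<close>
  define S where "S = T \<inter> {x. E x \<bullet> e \<noteq> 0}"
  have "open S"
  proof -
    have "open (T \<inter> (\<lambda>x. E x \<bullet> e) -` (- {0}))"
      using \<open>open T\<close> contE by (intro continuous_open_preimage continuous_intros) auto
    then show ?thesis
      by (simp add: S_def vimage_def)
  qed
  have "z \<in> T" using assms(2) by (simp add: T_def)
  moreover have "E z \<bullet> e \<noteq> 0"
    using eq[OF \<open>z \<in> T\<close>] nz by (auto simp: E_def)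
  ultimately have "z \<in> S" by (simp add: S_def)
  have N_eq: "N x = e - inverse (E x \<bullet> e) *\<^sub>R E x" if "x \<in> S" for x
  proof -
    have "E x \<bullet> e \<noteq> 0" "E x = (E x \<bullet> e) *\<^sub>R (e - N x)"
      using that eq[of x] by (auto simp: S_def E_def algebra_simps)
    then have "inverse (E x \<bullet> e) *\<^sub>R E x = e - N x"
      by (metis left_inverse scaleR_one scaleR_scaleR)
    then show ?thesis by simp
  qed
  define N' where "N' x h = - (inverse (E x \<bullet> e) *\<^sub>R E' x h
     - (inverse (E x \<bullet> e) * (E' x h \<bullet> e) * inverse (E x \<bullet> e)) *\<^sub>R E x)" for x h
  have "(N has_derivative N' x) (at x)" if "x \<in> S" for x
  proof (rule has_derivative_transform_within_open[of "\<lambda>x. e - inverse (E x \<bullet> e) *\<^sub>R E x", OF _ \<open>open S\<close> that])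
    have "x \<in> T" "E x \<bullet> e \<noteq> 0" using that by (auto simp: S_def)
    then show "((\<lambda>x. e - inverse (E x \<bullet> e) *\<^sub>R E x) has_derivative N' x) (at x)"
      by (auto intro!: derivative_eq_intros E simp: N'_def [abs_def] fun_eq_iff)
  qed (simp add: N_eq)
  moreover have "isCont (\<lambda>x. N' x h) z" for h
  proof -
    have lin: "linear (D' p)" if "p \<in> V" for p
      using D[OF that] by (rule has_derivative_linear)
    have D'c: "isCont (\<lambda>x. D' (graph_point x) h) z" for h
    proof (rule isCont_o2[of z graph_point "\<lambda>p. D' p h"])
      show "isCont graph_point z"
        using graph_point_has_derivative by (rule has_derivative_continuous)
      show "isCont (\<lambda>p. D' p h) (graph_point z)"
        using D' assms(1,2) by (simp add: continuous_on_eq_continuous_at)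
    qed
    \<comment> \<open>\<open>D'\<close> is known to be continuous for fixed directions, whereas
      \<open>\<gamma>' x h\<close> varies with \<open>x\<close>. Linearity splits it into the fixed
      directions \<open>h\<close> and \<open>e\<close> with continuous coefficients.\<close>
    have "isCont (\<lambda>x. D' (graph_point x) h + (N x \<bullet> h - h \<bullet> e) *\<^sub>R D' (graph_point x) e) z"
      by (intro continuous_intros D'c isCont_N)
    moreover have "\<forall>\<^sub>F x in nhds z. x \<in> T"
      using \<open>open T\<close> \<open>z \<in> T\<close> by (rule eventually_nhds_in_open)
    then have "\<forall>\<^sub>F x in nhds z. D' (graph_point x) h + (N x \<bullet> h - h \<bullet> e) *\<^sub>R D' (graph_point x) e = E' x h"
      by eventually_elim (simp add: T_def E'_def \<gamma>'_def linear_add[OF lin] linear_scale[OF lin])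
    ultimately have "isCont (\<lambda>x. E' x h) z"
      by (simp add: isCont_cong)
    moreover have "isCont E z"
      using E[OF \<open>z \<in> T\<close>] by (rule has_derivative_continuous)
    ultimately show ?thesis
      unfolding N'_def using \<open>E z \<bullet> e \<noteq> 0\<close> by (intro continuous_intros) auto
  qed
  ultimately show ?thesis
    using that \<open>open S\<close> \<open>z \<in> S\<close> by blast
qed

end

text \<open>Composition with the orthogonal projection \<open>P\<close> onto the hyperplane extends
  \<open>g\<close> and \<open>G\<close> to the whole space. As \<open>G\<close> is orthogonal to
  \<open>e\<close>, it remains the gradient; the bound
  \<open>norm (P x - P y) \<le> 2 * norm (x - y)\<close> doubles the Lipschitz constant.\<close>

lemma C11_on_hyperplaneE:
  assumes "C11_on_hyperplane e g" and e: "e \<in> Basis"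
  obtains N L where "C11_graph e (\<lambda>z. g (z - (z \<bullet> e) *\<^sub>R e)) N L"
proof -
  define H where "H = {y. y \<bullet> e = 0}"
  define P where "P z = z - (z \<bullet> e) *\<^sub>R e" for z
  obtain G L where G: "\<And>y. y \<in> H \<Longrightarrow> G y \<bullet> e = 0"
    and der: "\<And>y. y \<in> H \<Longrightarrow> (g has_derivative (\<lambda>h. G y \<bullet> h)) (at y within H)"
    and lip: "L-lipschitz_on H G"
    using assms(1) unfolding C11_on_hyperplane_def H_def by blast
  have ee: "e \<bullet> e = 1" using e by simp
  have PH: "P z \<in> H" for z
    by (simp add: P_def H_def inner_diff_left ee)
  have P_shift: "P (z + t *\<^sub>R e) = P z" for z t
    by (simp add: P_def inner_add_left ee algebra_simps)
  have "C11_graph e (\<lambda>z. g (P z)) (\<lambda>z. G (P z)) (L * 2)"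
  proof
    fix z x y :: 'a and t :: real
    have "(g has_derivative (\<lambda>h. G (P z) \<bullet> h)) (at (P z) within range P)"
      using PH by (intro has_derivative_subset[OF der]) auto
    moreover have "(P has_derivative P) (at z)"
      unfolding P_def [abs_def] by (auto intro!: derivative_eq_intros)
    ultimately have "((\<lambda>z. g (P z)) has_derivative (\<lambda>h. G (P z) \<bullet> P h)) (at z)"
      using has_derivative_in_compose by blast
    moreover have "G (P z) \<bullet> P h = G (P z) \<bullet> h" for h
      using G[OF PH] by (simp add: P_def inner_diff_right)
    ultimately show "((\<lambda>z. g (P z)) has_derivative (\<lambda>h. G (P z) \<bullet> h)) (at z)"
      by simp
    have "norm (P x - P y) \<le> norm (x - y) + norm (((x - y) \<bullet> e) *\<^sub>R e)"
      using norm_triangle_ineq4[of "x - y" "((x - y) \<bullet> e) *\<^sub>R e"]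
      by (simp add: P_def algebra_simps inner_diff_left)
    also have "\<dots> \<le> 2 * norm (x - y)"
      using Basis_le_norm[OF e, of "x - y"] e by simp
    finally have "norm (P x - P y) \<le> 2 * norm (x - y)" .
    moreover have "norm (G (P x) - G (P y)) \<le> L * norm (P x - P y)"
      using lipschitz_onD[OF lip PH PH] by (simp add: dist_norm)
    ultimately show "norm (G (P x) - G (P y)) \<le> L * 2 * norm (x - y)"
      using lipschitz_on_nonneg[OF lip]
      by (metis (no_types, opaque_lifting) mult.assoc mult_left_mono order_trans)
  qed (use e G PH P_shift in auto)
  then show ?thesis
    using that by (simp add: P_def)
qed

subsection \<open>The cut locus\<close>

text \<open>The boundary outside the ball around \<open>\<xi>\<close> is closed and contains no
  point nearest to \<open>x\<close>, so it is farther from \<open>x\<close> than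
  \<open>\<xi>\<close> by a positive gap. Moving \<open>x\<close> by less than half the gap changes
  the two distances too little to close it.\<close>

lemma boundary_proj_continuous:
  assumes "boundary_proj \<Omega> x = {\<xi>}" "\<epsilon> > 0"
  obtains \<delta> where "\<delta> > 0"
    "\<And>x' \<xi>'. dist x x' < \<delta> \<Longrightarrow> \<xi>' \<in> boundary_proj \<Omega> x' \<Longrightarrow> dist \<xi> \<xi>' < \<epsilon>"
proof (cases "frontier \<Omega> - ball \<xi> \<epsilon> = {}")
  case True
  then show ?thesis
    by (intro that[of 1]) (auto simp: boundary_proj_eq)
next
  case False
  have \<xi>: "\<xi> \<in> frontier \<Omega>" "\<And>\<eta>. \<eta> \<in> frontier \<Omega> \<Longrightarrow> dist x \<xi> \<le> dist x \<eta>"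
    using assms(1) by (auto simp: boundary_proj_eq)
  obtain \<eta> where \<eta>: "\<eta> \<in> frontier \<Omega> - ball \<xi> \<epsilon>"
    "\<And>\<zeta>. \<zeta> \<in> frontier \<Omega> - ball \<xi> \<epsilon> \<Longrightarrow> dist x \<eta> \<le> dist x \<zeta>"
    using distance_attains_inf[OF closed_Diff[OF frontier_closed open_ball] False, of x] by blast
  have "\<eta> \<notin> boundary_proj \<Omega> x"
    using \<eta>(1) assms by auto
  then obtain \<zeta> where "\<zeta> \<in> frontier \<Omega>" "dist x \<zeta> < dist x \<eta>"
    using \<eta>(1) by (auto simp: boundary_proj_eq not_le)
  then have less: "dist x \<xi> < dist x \<eta>"
    using \<xi>(2) by (meson le_less_trans)
  show ?thesis
  proof (rule that)
    show "(dist x \<eta> - dist x \<xi>) / 2 > 0" using less by simp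
    fix x' \<xi>' assume x': "dist x x' < (dist x \<eta> - dist x \<xi>) / 2" and "\<xi>' \<in> boundary_proj \<Omega> x'"
    then have \<xi>': "\<xi>' \<in> frontier \<Omega>" "dist x' \<xi>' \<le> dist x' \<xi>"
      using \<xi>(1) by (auto simp: boundary_proj_eq)
    have "dist x \<xi>' \<le> dist x x' + dist x' \<xi>'" "dist x' \<xi> \<le> dist x x' + dist x \<xi>"
      by metric+
    then have "dist x \<xi>' < dist x \<eta>"
      using x' \<xi>'(2) by (simp add: field_simps)
    then show "dist \<xi> \<xi>' < \<epsilon>"
      using \<eta>(2)[of \<xi>'] \<xi>'(1) by force
  qed
qed

text \<open>The slice \<open>S\<close> is a proper subspace because \<open>M\<close> has empty
  interior. Hence some nonzero \<open>a\<close> is orthogonal to \<open>S\<close>, and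
  \<open>a \<bullet> \<phi> x\<close> vanishes on \<open>M\<close>.\<close>

lemma C2_submanifold_defining_function:
  fixes M :: "'a::euclidean_space set"
  assumes "C2_submanifold k M" "p \<in> M" "interior M = {}"
  obtains V w D D' where "open V" "p \<in> V" "\<And>x. x \<in> M \<inter> V \<Longrightarrow> w x = 0"
    "\<And>x. x \<in> V \<Longrightarrow> (w has_derivative (\<lambda>h. D x \<bullet> h)) (at x)"
    "\<And>x. x \<in> V \<Longrightarrow> (D has_derivative D' x) (at x)"
    "\<And>h. continuous_on V (\<lambda>x. D' x h)" "D p \<noteq> 0"
proof -
  obtain V W \<phi> \<psi> and S :: "'a set" where V: "open V" "p \<in> V" and "open W" and hom: "homeomorphism V W \<phi> \<psi>"
    and C2: "C2_on V \<phi>" "C2_on W \<psi>" and S: "subspace S" and MV: "\<phi> ` (M \<inter> V) = S \<inter> W"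
    using assms(1,2) unfolding C2_submanifold_def by meson
  have \<psi>\<phi>: "\<psi> (\<phi> x) = x" and \<phi>W: "\<phi> x \<in> W" if "x \<in> V" for x
    using hom that by (auto simp: homeomorphism_def)
  have "S \<noteq> UNIV"
  proof
    assume "S = UNIV"
    have "V \<subseteq> M"
    proof
      fix x assume "x \<in> V"
      then obtain y where "y \<in> M \<inter> V" "\<phi> x = \<phi> y"
        using MV \<phi>W \<open>S = UNIV\<close> by blast
      then show "x \<in> M"
        using \<psi>\<phi> \<open>x \<in> V\<close> by (metis IntD1 IntD2)
    qed
    then show False
      using assms(3) V interior_maximal by blast
  qed
  then have "dim S < DIM('a)"
    using S dim_eq_full[of S] dim_subset_UNIV[of S] by (metis le_neq_implies_less span_eq_iff)
  then obtain a where "a \<noteq> 0" and a: "\<And>y. y \<in> S \<Longrightarrow> a \<bullet> y = 0"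
    using orthogonal_to_subspace_exists[of S] span_base unfolding orthogonal_def by metis
  obtain \<phi>' \<phi>'' where \<phi>': "\<And>x. x \<in> V \<Longrightarrow> (\<phi> has_derivative blinfun_apply (\<phi>' x)) (at x)"
    and \<phi>'': "\<And>x. x \<in> V \<Longrightarrow> (\<phi>' has_derivative blinfun_apply (\<phi>'' x)) (at x)"
    and cont: "continuous_on V \<phi>''"
    using C2(1) unfolding C2_on_def by blast
  obtain \<psi>' where \<psi>': "\<And>y. y \<in> W \<Longrightarrow> (\<psi> has_derivative blinfun_apply (\<psi>' y)) (at y)"
    using C2(2) unfolding C2_on_def by blast
  \<comment> \<open>\<open>D x\<close> is the vector representing the functional that maps
    \<open>h\<close> to \<open>a \<bullet> \<phi>' x h\<close>, assembled from its values on the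
    basis.\<close>
  define D where "D x = (\<Sum>b\<in>Basis. (a \<bullet> \<phi>' x b) *\<^sub>R b)" for x
  define D' where "D' x h = (\<Sum>b\<in>Basis. (a \<bullet> \<phi>'' x h b) *\<^sub>R b)" for x h
  have D_inner: "D x \<bullet> h = a \<bullet> \<phi>' x h" for x h
  proof -
    have "a \<bullet> \<phi>' x h = a \<bullet> \<phi>' x (\<Sum>b\<in>Basis. (h \<bullet> b) *\<^sub>R b)"
      by (simp add: euclidean_representation)
    also have "\<dots> = (\<Sum>b\<in>Basis. (h \<bullet> b) * (a \<bullet> \<phi>' x b))"
      by (simp add: blinfun.sum_right blinfun.scaleR_right inner_sum_right)
    also have "\<dots> = D x \<bullet> h"
      by (simp add: D_def inner_sum_left mult.commute inner_commute[of h])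
    finally show ?thesis by simp
  qed
  show ?thesis
  proof (rule that[of V "\<lambda>x. a \<bullet> \<phi> x" D D'])
    show "a \<bullet> \<phi> x = 0" if "x \<in> M \<inter> V" for x
      using that MV a by blast
    show "((\<lambda>x. a \<bullet> \<phi> x) has_derivative (\<lambda>h. D x \<bullet> h)) (at x)" if "x \<in> V" for x
      unfolding D_inner by (rule has_derivative_inner_right[OF \<phi>'[OF that]])
    show "(D has_derivative D' x) (at x)" if "x \<in> V" for x
      unfolding D_def [abs_def] D'_def [abs_def]
      by (intro has_derivative_sum has_derivative_scaleR_left has_derivative_inner_right
          bounded_linear.has_derivative[OF blinfun.bounded_linear_left \<phi>''[OF that]])
    show "continuous_on V (\<lambda>x. D' x h)" for h
      unfolding D'_def by (intro continuous_intros cont)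
    \<comment> \<open>\<open>\<phi>' p\<close> has the derivative of \<open>\<psi>\<close> as a left
      inverse, so it is surjective. If \<open>D p\<close> vanished, \<open>a\<close> would be
      orthogonal to its whole range and thus to itself.\<close>
    show "D p \<noteq> 0"
    proof
      assume "D p = 0"
      have "((\<lambda>x. \<psi> (\<phi> x)) has_derivative (\<lambda>h. \<psi>' (\<phi> p) (\<phi>' p h))) (at p)"
        by (rule has_derivative_compose[OF \<phi>'[OF V(2)] \<psi>'[OF \<phi>W[OF V(2)]]])
      moreover have "((\<lambda>x. \<psi> (\<phi> x)) has_derivative (\<lambda>h. h)) (at p)"
        by (rule has_derivative_transform_within_open[OF has_derivative_ident V]) (simp add: \<psi>\<phi>)
      ultimately have "(\<lambda>h. \<psi>' (\<phi> p) (\<phi>' p h)) = (\<lambda>h. h)"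
        by (rule has_derivative_unique)
      then have "inj (blinfun_apply (\<phi>' p))"
        by (metis injI)
      then have "surj (blinfun_apply (\<phi>' p))"
        by (intro linear_injective_imp_surjective)
          (auto simp: linear_conv_bounded_linear blinfun.bounded_linear_right)
      then obtain h where "\<phi>' p h = a"
        by (metis surjD)
      then have "a \<bullet> a = 0"
        using D_inner[of p h] \<open>D p = 0\<close> by simp
      then show False
        using \<open>a \<noteq> 0\<close> by simp
    qed
  qed (use V in auto)
qed

text \<open>In chart coordinates these cut points lie in two null sets: the image under
  \<open>normal_point\<close> of the cylinder over \<open>\<Gamma>\<close>, and the critical values
  of \<open>normal_point\<close>. The inverse motion \<open>\<Psi>\<close> carries null sets back to
  null sets.\<close>

lemma negligible_chart_cut_points:
  fixes \<Omega> \<Gamma> :: "(real ^ 'n) set" and Q :: "real ^ 'n \<Rightarrow> real ^ 'n"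
  assumes "CARD('n) \<ge> 2" "open \<Omega>"
    and null: "hausdorff_measure (CARD('n) - 1) \<Gamma> = 0"
    and C2: "\<And>\<xi>. \<xi> \<in> frontier \<Omega> - \<Gamma> \<Longrightarrow>
      \<exists>U. open U \<and> \<xi> \<in> U \<and> (\<exists>k. C2_submanifold k ((frontier \<Omega> - \<Gamma>) \<inter> U))"
    and Q: "orthogonal_transformation Q"
    and graph: "C11_graph e f N L"
    and "open U"
    and chart: "frontier \<Omega> \<inter> U = {x \<in> U. (Q x + b) \<bullet> e = f (Q x + b)}"
  shows "negligible {x \<in> cut_locus \<Omega> - singular_set \<Omega>. boundary_proj \<Omega> x \<inter> U \<noteq> {}}"
proof -
  interpret C11_graph e f N L by (fact graph)
  define \<Phi> where "\<Phi> x = Q x + b" for x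
  define \<Psi> where "\<Psi> y = inv Q (y - b)" for y
  have "bij Q" using Q by (rule orthogonal_transformation_bij)
  then have \<Phi>\<Psi> [simp]: "\<Phi> (\<Psi> y) = y" and \<Psi>\<Phi> [simp]: "\<Psi> (\<Phi> x) = x" for x y
    by (simp_all add: \<Phi>_def \<Psi>_def bij_inv_eq_iff bij_is_surj surj_f_inv_f bij_is_inj inv_f_f)
  have linQ: "linear Q" and inner_Q: "Q x \<bullet> Q y = x \<bullet> y" for x y
    using Q by (auto simp: orthogonal_transformation_def)
  have Qi: "orthogonal_transformation (inv Q)"
    using Q by (rule orthogonal_transformation_inv)
  then have blQ: "bounded_linear Q" and blQi: "bounded_linear (inv Q)"
    using Q by (simp_all add: linear_conv_bounded_linear[symmetric] orthogonal_transformation_linear)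
  have dist_\<Phi>: "dist (\<Phi> x) (\<Phi> y) = dist x y" for x y
    using Q by (simp add: \<Phi>_def dist_norm linear_diff[OF linQ, symmetric] orthogonal_transformation_norm)
  have \<Psi>_der: "(\<Psi> has_derivative inv Q) (at y)" for y
    unfolding \<Psi>_def [abs_def]
    using bounded_linear.has_derivative[OF blQi has_derivative_diff[OF has_derivative_ident has_derivative_const[of b]]]
    by simp
  have cont_\<Psi>: "continuous_on A \<Psi>" for A
    by (intro continuous_at_imp_continuous_on ballI has_derivative_continuous[OF \<Psi>_der])
  have on_graph: "\<Phi> \<xi> \<bullet> e = f (\<Phi> \<xi>)" if "\<xi> \<in> frontier \<Omega>" "\<xi> \<in> U" for \<xi>
    using chart that by (auto simp: \<Phi>_def)
  have in_frontier: "\<Psi> q \<in> frontier \<Omega>" if "\<Psi> q \<in> U" "q \<bullet> e = f q" for q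
  proof -
    have "\<Psi> q \<in> {x \<in> U. (Q x + b) \<bullet> e = f (Q x + b)}"
      using that \<Phi>\<Psi>[of q, unfolded \<Phi>_def] by simp
    then show ?thesis
      unfolding chart[symmetric] by simp
  qed
  \<comment> \<open>The argument at which \<open>nearest_graph_point\<close> represents
    \<open>\<Phi> x\<close>: the shift along \<open>e\<close> keeps the foot
    \<open>\<Phi> \<xi>\<close> and sets the normal parameter to
    \<open>(\<Phi> \<xi> - \<Phi> x) \<bullet> e\<close>.\<close>
  define \<zeta> where "\<zeta> x \<xi> = \<Phi> \<xi> - (\<Phi> x \<bullet> e) *\<^sub>R e" for x \<xi>
  have graph_point_\<zeta>: "graph_point (\<zeta> x \<xi>) = \<Phi> \<xi>" if "\<xi> \<in> frontier \<Omega>" "\<xi> \<in> U" for x \<xi>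
    using graph_point_shift[of "\<Phi> \<xi>" "- (\<Phi> x \<bullet> e)"] graph_point_eq[OF on_graph[OF that]]
    by (simp add: \<zeta>_def)
  have normal_point_\<zeta>: "normal_point (\<zeta> x \<xi>) = \<Phi> x" if "\<xi> \<in> boundary_proj \<Omega> x" "\<xi> \<in> U" for x \<xi>
  proof -
    have \<xi>: "\<xi> \<in> frontier \<Omega>" "\<And>\<eta>. \<eta> \<in> frontier \<Omega> \<Longrightarrow> dist x \<xi> \<le> dist x \<eta>"
      using that by (auto simp: boundary_proj_eq)
    have "\<Phi> x = normal_point (\<Phi> \<xi> - (\<Phi> x \<bullet> e) *\<^sub>R e)"
    proof (rule nearest_graph_point)
      show "open (\<Psi> -` U)"
        using \<open>open U\<close> cont_\<Psi> by (rule open_vimage)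
      show "\<Phi> \<xi> \<in> \<Psi> -` U" "\<Phi> \<xi> \<bullet> e = f (\<Phi> \<xi>)"
        using that on_graph[OF \<xi>(1)] by auto
      show "dist (\<Phi> x) (\<Phi> \<xi>) \<le> dist (\<Phi> x) q" if "q \<in> \<Psi> -` U" "q \<bullet> e = f q" for q
        using \<xi>(2)[OF in_frontier[of q]] that dist_\<Phi>[of x "\<Psi> q"] by (simp add: dist_\<Phi>)
    qed
    then show ?thesis by (simp add: \<zeta>_def)
  qed
  define Z where "Z = {z. \<exists>\<xi>\<in>\<Gamma>. \<forall>c\<in>Basis - {e}. z \<bullet> c = \<Phi> \<xi> \<bullet> c}"
  have Z: "negligible Z"
    unfolding Z_def using assms(1) e null dist_\<Phi> by (intro negligible_cylinder_hausdorff_null) auto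
  define K where "K = {z. \<exists>F'. (normal_point has_derivative F') (at z) \<and> \<not> inj F'}"
  have "negligible (normal_point ` K)"
  proof (rule negligible_critical_values)
    fix z assume "z \<in> K"
    then obtain F' where F': "(normal_point has_derivative F') (at z)" "\<not> inj F'"
      by (auto simp: K_def)
    then have "F' = frechet_derivative normal_point (at z)"
      by (intro frechet_derivative_at)
    with F' show "(normal_point has_derivative frechet_derivative normal_point (at z)) (at z)"
      "\<not> inj (frechet_derivative normal_point (at z))"
      by simp_all
  qed
  then have "negligible (\<Psi> ` (normal_point ` Z \<union> normal_point ` K))"
    using negligible_normal_point_image[OF Z] \<Psi>_der
    by (intro negligible_differentiable_image_negligible)
      (auto simp: differentiable_on_def intro: differentiableI has_derivative_at_withinI)
  moreover have "{x \<in> cut_locus \<Omega> - singular_set \<Omega>. boundary_proj \<Omega> x \<inter> U \<noteq> {}}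
      \<subseteq> \<Psi> ` (normal_point ` Z \<union> normal_point ` K)"
  proof
    fix x assume "x \<in> {x \<in> cut_locus \<Omega> - singular_set \<Omega>. boundary_proj \<Omega> x \<inter> U \<noteq> {}}"
    then have x: "x \<in> closure (singular_set \<Omega>)" "x \<in> \<Omega>" "x \<notin> singular_set \<Omega>" "boundary_proj \<Omega> x \<inter> U \<noteq> {}"
      by (auto simp: cut_locus_def)
    then obtain \<xi> where proj: "boundary_proj \<Omega> x = {\<xi>}" and "\<xi> \<in> U"
      by (auto simp: singular_set_def is_singleton_def)
    have \<xi>: "\<xi> \<in> boundary_proj \<Omega> x" "\<xi> \<in> frontier \<Omega>"
      using proj by (auto simp: boundary_proj_eq)
    define z where "z = \<zeta> x \<xi>"
    have \<Phi>x: "\<Phi> x = normal_point z"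
      using normal_point_\<zeta>[OF \<xi>(1) \<open>\<xi> \<in> U\<close>] by (simp add: z_def)
    have gz: "graph_point z = \<Phi> \<xi>"
      using graph_point_\<zeta>[OF \<xi>(2) \<open>\<xi> \<in> U\<close>] by (simp add: z_def)
    have "z \<in> Z \<union> K"
    proof (cases "\<xi> \<in> \<Gamma>")
      case True
      have "z \<bullet> c = \<Phi> \<xi> \<bullet> c" if "c \<in> Basis - {e}" for c
        using that e by (auto simp: z_def \<zeta>_def inner_diff_left inner_Basis)
      with True show ?thesis
        by (auto simp: Z_def)
    next
      case False
      define M where "M = frontier \<Omega> - \<Gamma>"
      obtain U' k where U': "open U'" "\<xi> \<in> U'" "C2_submanifold k (M \<inter> U')"
        using C2[of \<xi>] False \<xi>(2) unfolding M_def by blast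
      \<comment> \<open>A nonempty open subset of the boundary would meet \<open>\<Omega>\<close>,
        which is disjoint from its boundary. This rules out full-dimensional pieces of
        \<open>M\<close>, for which no defining function exists.\<close>
      have "interior (frontier \<Omega>) = {}"
      proof -
        have "interior (frontier \<Omega>) \<subseteq> closure \<Omega> - \<Omega>"
          using interior_subset[of "frontier \<Omega>"] \<open>open \<Omega>\<close> by (auto simp: frontier_def interior_open)
        then show ?thesis
          using open_Int_closure_eq_empty[OF open_interior, of "frontier \<Omega>" \<Omega>] by blast
      qed
      then have "interior (M \<inter> U') = {}"
        using interior_mono[of "M \<inter> U'" "frontier \<Omega>"] by (auto simp: M_def)
      then obtain V w D D' where V: "open V" "\<xi> \<in> V" "\<And>x. x \<in> M \<inter> U' \<inter> V \<Longrightarrow> w x = 0"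
        and w: "\<And>x. x \<in> V \<Longrightarrow> (w has_derivative (\<lambda>h. D x \<bullet> h)) (at x)"
        and D: "\<And>x. x \<in> V \<Longrightarrow> (D has_derivative D' x) (at x)"
        and D': "\<And>h. continuous_on V (\<lambda>x. D' x h)" and nz: "D \<xi> \<noteq> 0"
        using C2_submanifold_defining_function[OF U'(3), of \<xi>] False \<xi>(2) U'(2) unfolding M_def by blast
      \<comment> \<open>\<open>U\<close> makes the chart valid, \<open>U'\<close> the manifold
        structure and \<open>V\<close> the defining function.\<close>
      define V2 where "V2 = \<Psi> -` (V \<inter> U \<inter> U')"
      have "open V2"
        unfolding V2_def using V(1) U'(1) \<open>open U\<close> by (intro open_vimage cont_\<Psi> open_Int)
      have V2D: "\<Psi> y \<in> V" if "y \<in> V2" for y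
        using that by (simp add: V2_def)
      have w2: "((\<lambda>y. w (\<Psi> y)) has_derivative (\<lambda>h. Q (D (\<Psi> y)) \<bullet> h)) (at y)" if "y \<in> V2" for y
      proof -
        have "((\<lambda>y. w (\<Psi> y)) has_derivative (\<lambda>h. D (\<Psi> y) \<bullet> inv Q h)) (at y)"
          by (rule has_derivative_compose[OF \<Psi>_der w[OF V2D[OF that]]])
        moreover have "D (\<Psi> y) \<bullet> inv Q h = Q (D (\<Psi> y)) \<bullet> h" for h
          using inner_Q[of "D (\<Psi> y)" "inv Q h"] \<open>bij Q\<close> by (simp add: bij_is_surj surj_f_inv_f)
        ultimately show ?thesis by simp
      qed
      have D2: "((\<lambda>y. Q (D (\<Psi> y))) has_derivative (\<lambda>h. Q (D' (\<Psi> y) (inv Q h)))) (at y)" if "y \<in> V2" for y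
        by (rule bounded_linear.has_derivative[OF blQ has_derivative_compose[OF \<Psi>_der D[OF V2D[OF that]]]])
      have D2': "continuous_on V2 (\<lambda>y. Q (D' (\<Psi> y) (inv Q h)))" for h
        by (intro bounded_linear.continuous_on[OF blQ] continuous_on_compose2[OF D' cont_\<Psi>])
          (auto simp: V2_def)
      \<comment> \<open>\<open>\<Gamma>\<close> need not be closed, but it is null, so the zeros of \<open>w\<close> are dense in the graph.\<close>
      have zero: "w (\<Psi> (graph_point y)) = 0" if y: "graph_point y \<in> V2" for y
      proof (rule ccontr)
        assume nonzero: "w (\<Psi> (graph_point y)) \<noteq> 0"
        define T where "T = graph_point -` V2"
        have "open T"
          unfolding T_def using \<open>open V2\<close> continuous_on_graph_point by (rule open_vimage)
        have "continuous_on V2 (\<lambda>y. w (\<Psi> y))"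
          by (intro continuous_at_imp_continuous_on ballI has_derivative_continuous[OF w2])
        then have "continuous_on T (\<lambda>y. w (\<Psi> (graph_point y)))"
          by (rule continuous_on_compose2[OF _ continuous_on_graph_point]) (auto simp: T_def)
        then have "open (T \<inter> (\<lambda>y. w (\<Psi> (graph_point y))) -` (- {0}))"
          using \<open>open T\<close> by (intro continuous_open_preimage) auto
        moreover have "y \<in> T \<inter> (\<lambda>y. w (\<Psi> (graph_point y))) -` (- {0})"
          using y nonzero by (simp add: T_def)
        moreover have "T \<inter> (\<lambda>y. w (\<Psi> (graph_point y))) -` (- {0}) \<subseteq> Z"
        proof
          fix v assume "v \<in> T \<inter> (\<lambda>y. w (\<Psi> (graph_point y))) -` (- {0})"
          then have v: "\<Psi> (graph_point v) \<in> V \<inter> U \<inter> U'" "w (\<Psi> (graph_point v)) \<noteq> 0"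
            by (auto simp: T_def V2_def)
          then have "\<Psi> (graph_point v) \<in> frontier \<Omega>"
            by (intro in_frontier) (auto simp: graph_point_inner_e f_graph_point)
          then have "\<Psi> (graph_point v) \<in> \<Gamma>"
            using v V(3) unfolding M_def by blast
          moreover have "v \<bullet> c = graph_point v \<bullet> c" if "c \<in> Basis - {e}" for c
            using that e by (auto simp: graph_point_def inner_add_left inner_Basis)
          ultimately show "v \<in> Z"
            unfolding Z_def by (auto intro!: bexI[of _ "\<Psi> (graph_point v)"])
        qed
        ultimately show False
          using open_not_negligible Z negligible_subset by (metis empty_iff)
      qed
      have gz_V2: "graph_point z \<in> V2"
        using gz V(2) U'(2) \<open>\<xi> \<in> U\<close> by (simp add: V2_def)
      have nz2: "Q (D (\<Psi> (graph_point z))) \<noteq> 0"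
        using nz orthogonal_transformation_norm[OF Q, of "D \<xi>"] by (auto simp: gz)
      obtain S N' where "open S" "z \<in> S" "\<And>x. x \<in> S \<Longrightarrow> (N has_derivative N' x) (at x)"
        "\<And>h. isCont (\<lambda>x. N' x h) z"
        using C1_gradient_of_defining_function[OF \<open>open V2\<close> gz_V2 w2 D2 D2' zero nz2] by blast
      then obtain F' where F': "(normal_point has_derivative F') (at z)"
        and inj: "inj F' \<Longrightarrow> \<exists>r>0. inj_on normal_point (ball z r)"
        using normal_point_locally_injective by blast
      \<comment> \<open>Otherwise \<open>normal_point\<close> would be injective near
        \<open>z\<close>. But points \<open>x'\<close> of \<open>singular_set \<Omega>\<close>
        approach \<open>x\<close>, and two projections of one \<open>x'\<close> give two arguments
        near \<open>z\<close> with the common value \<open>\<Phi> x'\<close>.\<close>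
      have "\<not> inj F'"
      proof
        assume "inj F'"
        then obtain r where r: "r > 0" "inj_on normal_point (ball z r)"
          using inj by blast
        obtain s where s: "s > 0" "ball \<xi> s \<subseteq> U"
          using \<open>open U\<close> \<open>\<xi> \<in> U\<close> by (auto simp: open_contains_ball)
        \<comment> \<open>\<open>s\<close> keeps the projections of \<open>x'\<close> inside the
          chart; one \<open>r / 2\<close> bounds the displacement of the foot, the other that of
          \<open>x'\<close>, and together they bound the displacement of
          \<open>\<zeta>\<close>.\<close>
        have "min s (r / 2) > 0" using r s by simp
        then obtain \<delta> where \<delta>: "\<delta> > 0"
          "\<And>x' \<xi>'. dist x x' < \<delta> \<Longrightarrow> \<xi>' \<in> boundary_proj \<Omega> x' \<Longrightarrow> dist \<xi> \<xi>' < min s (r / 2)"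
          using boundary_proj_continuous[OF proj] by metis
        have "\<exists>x'\<in>singular_set \<Omega>. dist x' x < min \<delta> (r / 2)"
          using x(1)[unfolded closure_approachable, rule_format, of "min \<delta> (r / 2)"] \<delta>(1) r(1) by simp
        then obtain x' where x': "x' \<in> singular_set \<Omega>" "dist x x' < \<delta>" "dist x x' < r / 2"
          by (auto simp: dist_commute)
        have "boundary_proj \<Omega> x' \<noteq> {}"
          using \<xi>(2) by (intro boundary_proj_nonempty) auto
        then obtain \<xi>1 \<xi>2 where \<xi>12: "\<xi>1 \<in> boundary_proj \<Omega> x'" "\<xi>2 \<in> boundary_proj \<Omega> x'" "\<xi>1 \<noteq> \<xi>2"
          using x'(1) unfolding singular_set_def is_singleton_def by blast
        have near: "\<xi>' \<in> U" "\<zeta> x' \<xi>' \<in> ball z r" if "\<xi>' \<in> boundary_proj \<Omega> x'" for \<xi>'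
        proof -
          have d: "dist \<xi> \<xi>' < s" "dist \<xi> \<xi>' < r / 2"
            using \<delta>(2)[OF x'(2) that] by auto
          then show "\<xi>' \<in> U" using s by auto
          have "z - \<zeta> x' \<xi>' = (\<Phi> \<xi> - \<Phi> \<xi>') - ((\<Phi> x - \<Phi> x') \<bullet> e) *\<^sub>R e"
            by (simp add: z_def \<zeta>_def algebra_simps inner_diff_left)
          then have "norm (z - \<zeta> x' \<xi>') \<le> norm (\<Phi> \<xi> - \<Phi> \<xi>') + norm (((\<Phi> x - \<Phi> x') \<bullet> e) *\<^sub>R e)"
            by (metis norm_triangle_ineq4)
          also have "\<dots> \<le> dist \<xi> \<xi>' + dist x x'"
            using Basis_le_norm[OF e, of "\<Phi> x - \<Phi> x'"] e dist_\<Phi>[of \<xi> \<xi>'] dist_\<Phi>[of x x'] by (simp add: dist_norm)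
          finally show "\<zeta> x' \<xi>' \<in> ball z r"
            using d x'(3) by (simp add: dist_norm)
        qed
        have "\<zeta> x' \<xi>1 = \<zeta> x' \<xi>2"
        proof (rule inj_onD[OF r(2)])
          show "normal_point (\<zeta> x' \<xi>1) = normal_point (\<zeta> x' \<xi>2)"
            by (simp only: normal_point_\<zeta>[OF \<xi>12(1) near(1)[OF \<xi>12(1)]]
                normal_point_\<zeta>[OF \<xi>12(2) near(1)[OF \<xi>12(2)]])
        qed (rule near(2)[OF \<xi>12(1)], rule near(2)[OF \<xi>12(2)])
        \<comment> \<open>The foot recovers the projection from the argument, so equal arguments
          would merge \<open>\<xi>1\<close> and \<open>\<xi>2\<close>.\<close>
        moreover have "graph_point (\<zeta> x' \<xi>1) = \<Phi> \<xi>1" "graph_point (\<zeta> x' \<xi>2) = \<Phi> \<xi>2"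
          using graph_point_\<zeta>[OF _ near(1)] \<xi>12(1,2) by (simp_all add: boundary_proj_eq)
        ultimately show False
          using \<xi>12(3) \<Psi>\<Phi> by metis
      qed
      with F' show ?thesis
        by (auto simp: K_def)
    qed
    then show "x \<in> \<Psi> ` (normal_point ` Z \<union> normal_point ` K)"
      using \<Phi>x \<Psi>\<Phi>[of x] by (auto intro!: image_eqI[of x \<Psi> "\<Phi> x"])
  qed
  ultimately show ?thesis
    by (rule negligible_subset)
qed

section \<open>Passage from single charts to the whole boundary\<close>

theorem corollary4p2:
  fixes \<Omega> \<Gamma> :: "(real ^ 'n) set"
  assumes "CARD('n) \<ge> 2"
    and "open \<Omega>"
    and "frontier \<Omega> \<noteq> {}"
    and "C11_boundary \<Omega>"
    and "\<Gamma> \<subseteq> frontier \<Omega>"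
    and "hausdorff_measure (CARD('n) - 1) \<Gamma> = 0"
    and "\<forall>\<xi> \<in> frontier \<Omega> - \<Gamma>. \<exists>U. open U \<and> \<xi> \<in> U \<and>
           (\<exists>k. C2_submanifold k ((frontier \<Omega> - \<Gamma>) \<inter> U))"
  shows "cut_locus \<Omega> \<in> null_sets lebesgue"
proof -
  define X where "X U = {x \<in> cut_locus \<Omega> - singular_set \<Omega>. boundary_proj \<Omega> x \<inter> U \<noteq> {}}" for U
  \<comment> \<open>All open sets satisfying the local conclusion are collected. The charts show
    that they cover the boundary, and Lindelof's theorem leaves countably many, whose null sets can
    be united.\<close>
  define \<U> where "\<U> = {U. open U \<and> negligible (X U)}"
  have "\<exists>U\<in>\<U>. \<xi> \<in> U" if "\<xi> \<in> frontier \<Omega>" for \<xi>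
  proof -
    obtain U \<Phi> e g where U: "open U" "\<xi> \<in> U" and \<Phi>: "rigid_motion \<Phi>" and e: "e \<in> Basis"
      and C11: "C11_on_hyperplane e g"
      and chart: "frontier \<Omega> \<inter> U = {x \<in> U. \<Phi> x \<bullet> e = g (\<Phi> x - (\<Phi> x \<bullet> e) *\<^sub>R e)}"
      using assms(4)[unfolded C11_boundary_def, rule_format, OF \<open>\<xi> \<in> frontier \<Omega>\<close>] by blast
    obtain Q b where Q: "orthogonal_transformation Q" and \<Phi>_eq: "\<Phi> = (\<lambda>x. Q x + b)"
      using \<Phi> by (auto simp: rigid_motion_def)
    obtain N L where graph: "C11_graph e (\<lambda>z. g (z - (z \<bullet> e) *\<^sub>R e)) N L"
      using C11_on_hyperplaneE[OF C11 e] .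
    have "negligible (X U)"
      unfolding X_def using assms(7) chart
      by (intro negligible_chart_cut_points[OF assms(1,2,6) _ Q graph U(1)]) (auto simp: \<Phi>_eq)
    with U show ?thesis
      by (auto simp: \<U>_def)
  qed
  then have cover: "frontier \<Omega> \<subseteq> \<Union>\<U>"
    by blast
  obtain \<U>' where \<U>': "\<U>' \<subseteq> \<U>" "countable \<U>'" "\<Union>\<U>' = \<Union>\<U>"
    using Lindelof[of \<U>] by (auto simp: \<U>_def)
  have "negligible (singular_set \<Omega> \<union> (\<Union>U\<in>\<U>'. X U))"
    using \<U>' negligible_singular_set[OF assms(3)]
    by (intro negligible_Un negligible_countable_Union countable_image) (auto simp: \<U>_def)
  moreover have "cut_locus \<Omega> \<subseteq> singular_set \<Omega> \<union> (\<Union>U\<in>\<U>'. X U)"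
  proof
    fix x assume x: "x \<in> cut_locus \<Omega>"
    obtain \<xi> where "\<xi> \<in> boundary_proj \<Omega> x"
      using boundary_proj_nonempty[OF assms(3)] by blast
    moreover from this have "\<xi> \<in> \<Union>\<U>'"
      using cover \<U>'(3) by (auto simp: boundary_proj_eq)
    ultimately show "x \<in> singular_set \<Omega> \<union> (\<Union>U\<in>\<U>'. X U)"
      using x by (auto simp: X_def)
  qed
  ultimately show ?thesis
    using negligible_subset negligible_iff_null_sets by blast
qed

end
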